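(* Let $r$ be a complex number and $n\ge0$ an integer. Then, as polynomials in $x$, $$D_n^{(r)}(x)=D_n^{(r+1)}(x)+n(n-1)D_{n-2}^{(r+1)}(x)=\sum_{k=0}^{\lfloor n/2\rfloor}\binom{n}{2k}\binom{-r}{k}(2k)!\,D_{n-2k}^{(0)}(x),$$ where the term $n(n-1)D_{n-2}^{(r+1)}(x)$ is interpreted as $0$ when $n<2$.
   Context: For a complex number $a$ and integer $k\ge0$, $\binom{a}{k}=a(a-1)\cdots(a-k+1)/k!$. The polynomials $D_n^{(r)}(x)$ are defined by $D_{-1}^{(r)}(x)=0$, $D_0^{(r)}(x)=1$ and $D_{n+1}^{(r)}(x)=xD_n^{(r)}(x)-n(n+2r)D_{n-1}^{(r)}(x)$ for $n\ge0$. *)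

theory Defs
  imports Complex_Main "HOL-Computational_Algebra.Polynomial"
begin

text \<open>
  \<open>D_poly r n\<close> is the polynomial \<open>D\<^sub>n\<close> with parameter \<open>r\<close>.  The index is a natural number,
  so the convention that \<open>D\<close> vanishes at index \<open>-1\<close> is built into the value at index \<open>1\<close>;
  the lemma \<open>D_poly_rec\<close> recovers the recurrence for all \<open>n \<ge> 0\<close>.
\<close>

fun D_poly :: "complex \<Rightarrow> nat \<Rightarrow> complex poly" where
  "D_poly r 0 = 1"
| "D_poly r (Suc 0) = [:0, 1:]"
| "D_poly r (Suc (Suc n)) =
     [:0, 1:] * D_poly r (Suc n)
       - smult (of_nat (Suc n) * (of_nat (Suc n) + 2 * r)) (D_poly r n)"

lemma D_poly_rec:
  "D_poly r (n + 1) =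
     [:0, 1:] * D_poly r n
       - smult (of_nat n * (of_nat n + 2 * r)) (if n = 0 then 0 else D_poly r (n - 1))"
  by (cases n) simp_all

end

theory Submission
  imports Defs
begin

text \<open>
  The first identity is an induction using the recurrence for both parameters.  For the second,
  the right-hand side satisfies the recurrence of the left-hand side: multiplying by \<open>x\<close> and applying
  \<open>x D\<^sub>m = D\<^sub>m\<^sub>+\<^sub>1 + m\<^sup>2 D\<^sub>m\<^sub>-\<^sub>1\<close> at parameter \<open>0\<close> reduces this to a relation between coefficients,
  which amounts to \<open>(k + 1) b\<^sub>k\<^sub>+\<^sub>1 = (- r - k) b\<^sub>k\<close> for \<open>b\<^sub>k = (- r) gchoose k\<close>.
\<close>

lemma poly_D_poly_Suc_Suc:
  "poly (D_poly r (Suc (Suc n))) x =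
     x * poly (D_poly r (Suc n)) x - (of_nat n + 1) * (of_nat n + 1 + 2 * r) * poly (D_poly r n) x"
  by (simp add: algebra_simps)

text \<open>For \<open>n < 2\<close> the factor \<open>n (n - 1)\<close> vanishes, so the truncated
  index \<open>n - 2\<close> does no harm and no case distinction is needed in the
  statement.\<close>

lemma poly_D_poly_shift:
  "poly (D_poly r n) x =
     poly (D_poly (r + 1) n) x + of_nat n * (of_nat n - 1) * poly (D_poly (r + 1) (n - 2)) x"
proof (induction r n rule: D_poly.induct)
  case (3 r n)
  consider "n = 0" | "n = 1" | m where "n = Suc (Suc m)"
    by (metis One_nat_def not0_implies_Suc)
  then show ?case
  proof cases
    case 3
    show ?thesis
      \<comment> \<open>Once the induction hypotheses have moved everything to parameter
        \<open>r + 1\<close>, the recurrence lowers all indices to \<open>m + 1\<close> and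
        \<open>m\<close>, which leaves a ring identity.\<close>
      unfolding poly_D_poly_Suc_Suc[of r] "3.IH"
      unfolding 3 poly_D_poly_Suc_Suc[of "r + 1" "Suc (Suc m)"]
        poly_D_poly_Suc_Suc[of "r + 1" "Suc m"]
      by (simp add: poly_D_poly_Suc_Suc del: D_poly.simps) algebra
  qed (simp_all add: algebra_simps)
qed simp_all

definition falling :: "'a::comm_ring_1 \<Rightarrow> nat \<Rightarrow> 'a" where
  "falling a m = (\<Prod>i<m. a - of_nat i)"

lemma falling_0 [simp]: "falling a 0 = 1"
  by (simp add: falling_def)

lemma falling_Suc: "falling a (Suc m) = falling a m * (a - of_nat m)"
  by (simp add: falling_def)

lemma falling_plus1: "falling (a + 1) (Suc m) = (a + 1) * falling a m"
  by (simp add: falling_def prod.lessThan_Suc_shift del: prod.lessThan_Suc)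

lemma falling_of_nat_eq_0: "n < m \<Longrightarrow> falling (of_nat n) m = 0"
  unfolding falling_def by (rule prod_zero) (auto intro!: bexI[of _ n])

lemma gbinomial_mult_fact_falling:
  fixes a :: "'a::field_char_0"
  shows "(a gchoose m) * fact m = falling a m"
  using gbinomial_mult_fact'[of a m] by (simp add: falling_def atLeast0LessThan)

text \<open>Merging \<open>n gchoose (2 * k)\<close> with \<open>fact (2 * k)\<close> into a falling
  factorial makes the change under \<open>n + 1\<close> a matter of peeling off factors.\<close>

definition expansion_coeff :: "complex \<Rightarrow> nat \<Rightarrow> nat \<Rightarrow> complex" where
  "expansion_coeff r n k = falling (of_nat n) (2 * k) * ((- r) gchoose k)"

lemma expansion_coeff_0 [simp]: "expansion_coeff r n 0 = 1"
  by (simp add: expansion_coeff_def)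

lemma expansion_coeff_eq_0: "n < 2 * k \<Longrightarrow> expansion_coeff r n k = 0"
  by (simp add: expansion_coeff_def falling_of_nat_eq_0)

text \<open>This compares the coefficients of \<open>D_poly 0 (n - 2 * k)\<close> in the recurrence
  for the right-hand side; the square comes from expanding
  \<open>x * D_poly 0 (n + 1 - 2 * k)\<close>.\<close>

lemma expansion_coeff_rec:
  "expansion_coeff r (Suc (Suc n)) (Suc k) =
     expansion_coeff r (Suc n) (Suc k)
       + expansion_coeff r (Suc n) k * (of_nat (Suc n) - of_nat (2 * k))\<^sup>2
       - (of_nat n + 1) * (of_nat n + 1 + 2 * r) * expansion_coeff r n k"
proof -
  define N :: complex where "N = of_nat n"
  define K :: complex where "K = of_nat k"
  define F where "F = falling N (2 * k)"
  define G where "G = falling (N + 1) (2 * k)"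
  define b where "b = (- r) gchoose k"
  define c where "c = (- r) gchoose (Suc k)"
  \<comment> \<open>The first and the last factor of \<open>falling (N + 1) (2 * k + 1)\<close> are
    split off in turn; no division occurs, as \<open>N + 1 - 2 * K\<close> may be 0.\<close>
  have G: "G * (N + 1 - 2 * K) = (N + 1) * F"
    using falling_plus1[of N "2 * k"] falling_Suc[of "N + 1" "2 * k"]
    by (simp add: F_def G_def K_def)
  have c: "(K + 1) * c = (- r - K) * b"
    using gbinomial_mult_1[of "- r" k] by (simp add: K_def b_def c_def algebra_simps)
  have f1: "falling (N + 1) (2 * Suc k) = (N + 1) * F * (N - 2 * K)"
    using falling_plus1[of N "Suc (2 * k)"] falling_Suc[of N "2 * k"]
    by (simp add: F_def K_def)
  have f2: "falling (N + 1 + 1) (2 * Suc k) = (N + 2) * (N + 1) * F"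
    using falling_plus1[of "N + 1" "Suc (2 * k)"] falling_plus1[of N "2 * k"]
    by (simp add: F_def add.assoc)
  \<comment> \<open>By \<open>G\<close>, every term has the factor \<open>(N + 1) * F\<close>; what
    remains is twice the relation \<open>c\<close>.\<close>
  have "(N + 2) * (N + 1) * F * c =
      (N + 1) * F * (N - 2 * K) * c + G * b * (N + 1 - 2 * K)\<^sup>2
        - (N + 1) * (N + 1 + 2 * r) * (F * b)"
    using G c by algebra
  moreover have "of_nat (Suc n) = N + 1" "of_nat (Suc (Suc n)) = N + 1 + 1"
      "of_nat (2 * k) = 2 * K"
    by (simp_all add: N_def K_def)
  ultimately show ?thesis
    unfolding expansion_coeff_def N_def[symmetric] c_def[symmetric] b_def[symmetric]
    by (simp only: f1 f2 F_def[symmetric] G_def[symmetric])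
qed

definition expansion :: "complex \<Rightarrow> nat \<Rightarrow> complex \<Rightarrow> complex" where
  "expansion r n x = (\<Sum>k\<le>n div 2. expansion_coeff r n k * poly (D_poly 0 (n - 2 * k)) x)"

text \<open>The added terms have \<open>n < 2 * k\<close>, hence coefficient 0. This gives sums for
  different \<open>n\<close> a common range.\<close>

lemma expansion_eq_sum:
  assumes "n div 2 \<le> M"
  shows "expansion r n x = (\<Sum>k\<le>M. expansion_coeff r n k * poly (D_poly 0 (n - 2 * k)) x)"
  unfolding expansion_def
  by (rule sum.mono_neutral_left) (use assms in \<open>auto intro!: expansion_coeff_eq_0\<close>)

lemma expansion_coeff_times_D_poly:
  "expansion_coeff r (Suc n) k * (x * poly (D_poly 0 (Suc n - 2 * k)) x) =
     expansion_coeff r (Suc n) k * poly (D_poly 0 (Suc (Suc n) - 2 * k)) x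
       + expansion_coeff r (Suc n) k * (of_nat (Suc n) - of_nat (2 * k))\<^sup>2
           * poly (D_poly 0 (n - 2 * k)) x"
proof -
  consider "Suc n < 2 * k" | "Suc n = 2 * k" | m where "n = 2 * k + m"
    by (metis le_add_diff_inverse linorder_less_linear less_Suc_eq_le)
  then show ?thesis
  proof cases
    case 1
    then show ?thesis by (simp add: expansion_coeff_eq_0)
  next
    case 2
    \<comment> \<open>Here \<open>n - 2 * k\<close> is truncated to 0, but its term has the factor
      \<open>(n + 1 - 2 * k)^2 = 0\<close>; the claim becomes \<open>x * 1 = x\<close>.\<close>
    then have "Suc (Suc n) - 2 * k = Suc 0" "Suc n - 2 * k = 0" by simp_all
    then show ?thesis using 2 by simp
  next
    case 3
    then have "Suc (Suc n) - 2 * k = Suc (Suc m)" "Suc n - 2 * k = Suc m" "n - 2 * k = m"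
      by simp_all
    moreover have "(of_nat (Suc n) - of_nat (2 * k) :: complex) = of_nat m + 1"
      using 3 by simp
    ultimately show ?thesis
      by (simp only: poly_D_poly_Suc_Suc) (simp add: algebra_simps power2_eq_square)
  qed
qed

lemma expansion_rec:
  "expansion r (Suc (Suc n)) x =
     x * expansion r (Suc n) x - (of_nat n + 1) * (of_nat n + 1 + 2 * r) * expansion r n x"
proof -
  let ?D = "\<lambda>m. poly (D_poly 0 m) x"
  let ?c = "expansion_coeff r"
  let ?d = "\<lambda>k. (of_nat (Suc n) - of_nat (2 * k) :: complex)\<^sup>2"
  have "x * expansion r (Suc n) x =
      (\<Sum>k\<le>Suc n. ?c (Suc n) k * (x * ?D (Suc n - 2 * k)))"
    by (subst expansion_eq_sum[of _ "Suc n"]) (simp_all only: sum_distrib_left mult_ac div_le_dividend)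
  also have "\<dots> = (\<Sum>k\<le>Suc n. ?c (Suc n) k * ?D (Suc (Suc n) - 2 * k))
      + (\<Sum>k\<le>Suc n. ?c (Suc n) k * ?d k * ?D (n - 2 * k))"
    by (simp only: expansion_coeff_times_D_poly sum.distrib)
  \<comment> \<open>Splitting off \<open>k = 0\<close> and shifting \<open>k\<close> turns the index
    into \<open>n - 2 * k\<close>, as in the other sums.\<close>
  also have "(\<Sum>k\<le>Suc n. ?c (Suc n) k * ?D (Suc (Suc n) - 2 * k))
      = ?D (Suc (Suc n)) + (\<Sum>k\<le>n. ?c (Suc n) (Suc k) * ?D (n - 2 * k))"
    by (subst sum.atMost_Suc_shift) (simp del: D_poly.simps)
  \<comment> \<open>The top term \<open>k = n + 1\<close> vanishes because
    \<open>n + 1 < 2 * (n + 1)\<close>.\<close>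
  also have "(\<Sum>k\<le>Suc n. ?c (Suc n) k * ?d k * ?D (n - 2 * k))
      = (\<Sum>k\<le>n. ?c (Suc n) k * ?d k * ?D (n - 2 * k))"
    by (cases n) (simp_all add: expansion_coeff_eq_0)
  finally have *: "x * expansion r (Suc n) x =
      ?D (Suc (Suc n)) + (\<Sum>k\<le>n. ?c (Suc n) (Suc k) * ?D (n - 2 * k))
        + (\<Sum>k\<le>n. ?c (Suc n) k * ?d k * ?D (n - 2 * k))"
    by simp
  have "expansion r (Suc (Suc n)) x =
      (\<Sum>k\<le>Suc n. ?c (Suc (Suc n)) k * ?D (Suc (Suc n) - 2 * k))"
    by (rule expansion_eq_sum) simp
  also have "\<dots> = ?D (Suc (Suc n)) + (\<Sum>k\<le>n. ?c (Suc (Suc n)) (Suc k) * ?D (n - 2 * k))"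
    by (subst sum.atMost_Suc_shift) (simp del: D_poly.simps)
  finally show ?thesis
    unfolding * expansion_eq_sum[of n n r x, OF div_le_dividend] expansion_coeff_rec
    by (simp add: algebra_simps sum.distrib sum_subtractf sum_distrib_left del: D_poly.simps of_nat_Suc)
qed

text \<open>Both sides obey the same second-order recurrence and agree at \<open>n = 0\<close> and
  \<open>n = 1\<close>.\<close>

lemma poly_D_poly_eq_expansion: "poly (D_poly r n) x = expansion r n x"
proof (induction r n rule: D_poly.induct)
  case (3 r n)
  then show ?case by (simp only: poly_D_poly_Suc_Suc expansion_rec)
qed (simp_all add: expansion_def)

theorem theorem3p6:
  fixes r :: complex and n :: nat
  shows "D_poly r n =
           D_poly (r + 1) n
             + (if n < 2 then 0
                else smult (of_nat n * (of_nat n - 1)) (D_poly (r + 1) (n - 2)))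
       \<and> D_poly r n =
           (\<Sum>k = 0..n div 2.
              smult ((of_nat n gchoose (2 * k)) * ((- r) gchoose k) * fact (2 * k))
                (D_poly 0 (n - 2 * k)))"
proof
  have "n < 2 \<longleftrightarrow> n = 0 \<or> n = 1"
    by auto
  then show "D_poly r n =
      D_poly (r + 1) n
        + (if n < 2 then 0
           else smult (of_nat n * (of_nat n - 1)) (D_poly (r + 1) (n - 2)))"
    \<comment> \<open>Polynomials over the infinite field of complex numbers are equal once their
      values agree everywhere.\<close>
    using poly_D_poly_shift[of r n] by (auto simp: poly_eq_poly_eq_iff[symmetric] fun_eq_iff)
  have "(of_nat n gchoose (2 * k)) * ((- r) gchoose k) * fact (2 * k) = expansion_coeff r n k" for k
    unfolding expansion_coeff_def gbinomial_mult_fact_falling[symmetric] by (simp only: mult_ac)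
  then show "D_poly r n =
      (\<Sum>k = 0..n div 2.
         smult ((of_nat n gchoose (2 * k)) * ((- r) gchoose k) * fact (2 * k))
           (D_poly 0 (n - 2 * k)))"
    by (simp add: poly_eq_poly_eq_iff[symmetric] fun_eq_iff poly_sum poly_D_poly_eq_expansion[of r]
        expansion_def atLeast0AtMost)
qed

end
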